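(* (1) For every sub-identical order function $f\colon \mathbb{N} \to [0,\infty)$ there is a fast-growing order function $q\colon \mathbb{N} \to (1,\infty)$ such that $\mathrm{LUA}(q) \leq_{\mathrm{s}} \mathrm{COMPLEX}(f)$. (2) For every fast-growing order function $p\colon \mathbb{N} \to (1,\infty)$ there is a sub-identical order function $g\colon \mathbb{N} \to [0,\infty)$ such that $\mathrm{COMPLEX}(g) \leq_{\mathrm{s}} \mathrm{LUA}(p)$.
   Context: An order function is a computable (i.e. its values are uniformly computable reals), nondecreasing, unbounded function $\mathbb{N}\to\mathbb{R}$. A function $f\colon\mathbb{N}\to[0,\infty)$ is sub-identical if $\lim_{n\to\infty}(n-f(n))=\infty$. An order function $p\colon\mathbb{N}\to(1,\infty)$ is fast-growing if $\sum_{n=0}^\infty p(n)^{-1}<\infty$. Prefix-free complexity: a prefix-free machine is a partial recursive $M$ from $\{0,1\}^*$ to $\{0,1\}^*$ with prefix-free domain; $U$ is universal if for each prefix-free machine $M$ there is $\rho$ with $U(\rho^\frown\tau)\simeq M(\tau)$ for all $\tau$. Fix a universal $U$ and let $K(\sigma)=\min\{|\tau| : U(\tau)=\sigma\}$. For $f\colon\mathbb{N}\to\mathbb{R}$, $\mathrm{COMPLEX}(f)$ is the set of $X\in\{0,1\}^{\mathbb{N}}$ for which there is $c\in\mathbb{N}$ with $K(X\upharpoonright n)\geq f(n)-c$ for all $n$. A partial recursive $\psi\colon\subseteq\mathbb{N}\to\mathbb{N}$ is linearly universal if for every partial recursive $\theta\colon\subseteq\mathbb{N}\to\mathbb{N}$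 there are $a,b\in\mathbb{N}$ with $\psi(ax+b)\simeq\theta(x)$ for all $x$. For $p\colon\mathbb{N}\to(1,\infty)$, $\mathrm{LUA}(p)$ is the set of $X\in\mathbb{N}^{\mathbb{N}}$ such that $X(n)<p(n)$ for all $n$ and, for some linearly universal partial recursive $\psi$, there is no $n\in\operatorname{dom}\psi$ with $X(n)=\psi(n)$. For $P,Q\subseteq\mathbb{N}^{\mathbb{N}}$, $P\leq_{\mathrm{s}}Q$ (strong/Medvedev reducibility) means there is a partial recursive functional defined on all of $Q$ that maps $Q$ into $P$. *)

theory Defs
  imports Complex_Main "HOL-Library.Sublist"
begin

section \<open>Partial recursive functions and functionals\<close>

text \<open>
  Kleene's schemes, with an oracle. The terms carry no arities: a term denotes a partial
  function on argument lists of every length, and on arguments of a fixed length this is a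
  partial recursive function (relative to the oracle \<open>X\<close>). The recursion argument of
  \<open>PrimRec\<close> and the minimisation argument of \<open>Mu\<close> come first.
\<close>

datatype recf =
    Zero
  | Succ
  | Proj nat
  | Oracle
  | Comp recf "recf list"
  | PrimRec recf recf
  | Mu recf

fun run :: "(nat \<Rightarrow> nat) \<Rightarrow> recf \<Rightarrow> nat list \<Rightarrow> nat option" where
  "run X Zero xs = Some 0"
| "run X Succ xs = (case xs of [] \<Rightarrow> None | x # _ \<Rightarrow> Some (Suc x))"
| "run X (Proj i) xs = (if i < length xs then Some (xs ! i) else None)"
| "run X Oracle xs = (case xs of [] \<Rightarrow> None | x # _ \<Rightarrow> Some (X x))"
| "run X (Comp f gs) xs =
     (let ys = map (\<lambda>g. run X g xs) gs
      in if None \<in> set ys then None else run X f (map the ys))"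
| "run X (PrimRec f g) xs =
     (case xs of
        [] \<Rightarrow> None
      | n # zs \<Rightarrow>
          rec_nat (run X f zs) (\<lambda>k r. case r of None \<Rightarrow> None | Some v \<Rightarrow> run X g (k # v # zs)) n)"
| "run X (Mu f) xs =
     (let P = (\<lambda>n. run X f (n # xs) = Some 0 \<and> (\<forall>m<n. \<exists>y>0. run X f (m # xs) = Some y))
      in if \<exists>n. P n then Some (THE n. P n) else None)"

fun oracle_free :: "recf \<Rightarrow> bool" where
  "oracle_free Oracle = False"
| "oracle_free (Comp f gs) = (oracle_free f \<and> (\<forall>g\<in>set gs. oracle_free g))"
| "oracle_free (PrimRec f g) = (oracle_free f \<and> oracle_free g)"
| "oracle_free (Mu f) = oracle_free f"
| "oracle_free _ = True"

text \<open>The oracle \<open>\<lambda>_. 0\<close> below is a dummy: oracle-free terms never consult it.\<close>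

definition partial_recursive :: "(nat \<Rightarrow> nat option) \<Rightarrow> bool" where
  "partial_recursive \<psi> \<longleftrightarrow> (\<exists>e. oracle_free e \<and> (\<forall>x. \<psi> x = run (\<lambda>_. 0) e [x]))"

definition total_recursive2 :: "(nat \<Rightarrow> nat \<Rightarrow> nat) \<Rightarrow> bool" where
  "total_recursive2 h \<longleftrightarrow> (\<exists>e. oracle_free e \<and> (\<forall>x y. run (\<lambda>_. 0) e [x, y] = Some (h x y)))"

definition partial_recursive_functional ::
    "((nat \<Rightarrow> nat) \<Rightarrow> (nat \<Rightarrow> nat) option) \<Rightarrow> bool" where
  "partial_recursive_functional \<Psi> \<longleftrightarrow>
     (\<exists>e. \<forall>X. \<Psi> X = (if \<forall>n. run X e [n] \<noteq> None then Some (\<lambda>n. the (run X e [n])) else None))"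

definition strongly_reducible ::
    "(nat \<Rightarrow> nat) set \<Rightarrow> (nat \<Rightarrow> nat) set \<Rightarrow> bool"  (infix "\<le>\<^sub>s" 50) where
  "P \<le>\<^sub>s Q \<longleftrightarrow>
     (\<exists>\<Psi>. partial_recursive_functional \<Psi> \<and> (\<forall>X\<in>Q. \<exists>Y\<in>P. \<Psi> X = Some Y))"


section \<open>Order functions\<close>

text \<open>
  Uniformly computable reals: a recursive procedure yields, from \<open>n\<close> and \<open>k\<close>, a rational within
  \<open>2\<^sup>-\<^sup>k\<close> of \<open>f n\<close>. Rationals are presented as \<open>(a - b) / (c + 1)\<close> with natural \<open>a\<close>, \<open>b\<close>, \<open>c\<close>.
\<close>

definition computable_real_fun :: "(nat \<Rightarrow> real) \<Rightarrow> bool" where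
  "computable_real_fun f \<longleftrightarrow>
     (\<exists>a b c. total_recursive2 a \<and> total_recursive2 b \<and> total_recursive2 c \<and>
        (\<forall>n k. \<bar>f n - (real (a n k) - real (b n k)) / (real (c n k) + 1)\<bar> \<le> 1 / 2 ^ k))"

definition order_function :: "(nat \<Rightarrow> real) \<Rightarrow> bool" where
  "order_function f \<longleftrightarrow> computable_real_fun f \<and> mono f \<and> (\<forall>B. \<exists>n. f n > B)"

definition sub_identical :: "(nat \<Rightarrow> real) \<Rightarrow> bool" where
  "sub_identical f \<longleftrightarrow> (\<forall>n. f n \<ge> 0) \<and> filterlim (\<lambda>n. real n - f n) at_top sequentially"

definition fast_growing :: "(nat \<Rightarrow> real) \<Rightarrow> bool" where
  "fast_growing p \<longleftrightarrow> (\<forall>n. p n > 1) \<and> summable (\<lambda>n. inverse (p n))"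


section \<open>Prefix-free complexity\<close>

text \<open>Binary strings are identified with natural numbers by bijective base-2 numeration.\<close>

fun str_code :: "bool list \<Rightarrow> nat" where
  "str_code [] = 0"
| "str_code (b # \<sigma>) = 2 * str_code \<sigma> + (if b then 2 else 1)"

lemma bij_str_code: "bij str_code"
proof (rule bijI)
  show "inj str_code"
  proof (rule injI)
    fix \<sigma> \<tau>
    show "str_code \<sigma> = str_code \<tau> \<Longrightarrow> \<sigma> = \<tau>"
    proof (induction \<sigma> arbitrary: \<tau>)
      case Nil
      then show ?case by (cases \<tau>) (auto split: if_splits)
    next
      case (Cons b \<sigma>)
      then obtain c \<rho> where \<tau>: "\<tau> = c # \<rho>" by (cases \<tau>) (auto split: if_splits)
      with Cons.prems have "b = c \<and> str_code \<sigma> = str_code \<rho>"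
        by (simp split: if_splits) presburger+
      with Cons.IH \<tau> show ?case by blast
    qed
  qed
  have "\<exists>\<sigma>. str_code \<sigma> = n" for n
  proof (induction n rule: less_induct)
    case (less n)
    show ?case
    proof (cases "n = 0")
      case True
      then show ?thesis by (metis str_code.simps(1))
    next
      case False
      define b where "b = even n"
      define m where "m = (n - 1) div 2"
      have "m < n" and n: "n = 2 * m + (if b then 2 else 1)"
        using False by (simp_all add: m_def b_def) presburger+
      then obtain \<sigma> where "str_code \<sigma> = m" using less.IH by blast
      with n have "str_code (b # \<sigma>) = n" by simp
      then show ?thesis by blast
    qed
  qed
  then show "surj str_code" unfolding surj_def by metis
qed

definition prefix_free_machine :: "(bool list \<Rightarrow> bool list option) \<Rightarrow> bool" where
  "prefix_free_machine M \<longleftrightarrow>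
     (\<exists>\<psi>. partial_recursive \<psi> \<and> (\<forall>\<sigma>. \<psi> (str_code \<sigma>) = map_option str_code (M \<sigma>))) \<and>
     (\<forall>\<sigma>\<in>dom M. \<forall>\<tau>\<in>dom M. prefix \<sigma> \<tau> \<longrightarrow> \<sigma> = \<tau>)"

definition universal_prefix_free_machine :: "(bool list \<Rightarrow> bool list option) \<Rightarrow> bool" where
  "universal_prefix_free_machine U \<longleftrightarrow>
     prefix_free_machine U \<and>
     (\<forall>M. prefix_free_machine M \<longrightarrow> (\<exists>\<rho>. \<forall>\<tau>. U (\<rho> @ \<tau>) = M \<tau>))"

definition K :: "(bool list \<Rightarrow> bool list option) \<Rightarrow> bool list \<Rightarrow> nat" where
  "K U \<sigma> = (LEAST k. \<exists>\<tau>. length \<tau> = k \<and> U \<tau> = Some \<sigma>)"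

text \<open>
  Cantor space is the set of \<open>X :: nat \<Rightarrow> nat\<close> with values in \<open>{0, 1}\<close>, so that
  \<open>COMPLEX U f\<close> is a subset of Baire space.
\<close>

definition initial_segment :: "(nat \<Rightarrow> nat) \<Rightarrow> nat \<Rightarrow> bool list" where
  "initial_segment X n = map (\<lambda>i. X i = 1) [0..<n]"

definition COMPLEX :: "(bool list \<Rightarrow> bool list option) \<Rightarrow> (nat \<Rightarrow> real) \<Rightarrow> (nat \<Rightarrow> nat) set" where
  "COMPLEX U f =
     {X. (\<forall>n. X n \<in> {0, 1}) \<and>
         (\<exists>c::nat. \<forall>n. real (K U (initial_segment X n)) \<ge> f n - real c)}"


section \<open>Avoidance of linearly universal functions\<close>

definition linearly_universal :: "(nat \<Rightarrow> nat option) \<Rightarrow> bool" where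
  "linearly_universal \<psi> \<longleftrightarrow>
     partial_recursive \<psi> \<and>
     (\<forall>\<theta>. partial_recursive \<theta> \<longrightarrow> (\<exists>a b. \<forall>x. \<psi> (a * x + b) = \<theta> x))"

definition LUA :: "(nat \<Rightarrow> real) \<Rightarrow> (nat \<Rightarrow> nat) set" where
  "LUA p =
     {X. (\<forall>n. real (X n) < p n) \<and>
         (\<exists>\<psi>. linearly_universal \<psi> \<and> \<not> (\<exists>n\<in>dom \<psi>. \<psi> n = Some (X n)))}"

end

theory Submission
  imports Defs "HOL-Library.Discrete_Functions"
begin

text \<open>
  For (1), the hypothesis on \<open>U\<close> already yields a linearly universal function, with no need of an
  enumeration theorem: \<open>\<psi>\<^sub>0 (2\<^sup>e (2 x + 1)) = U (\<rho> 0\<^sup>x 1)\<close>, where \<open>e\<close> codes \<open>\<rho>\<close>. The string coded by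
  \<open>\<psi>\<^sub>0 n\<close> has complexity at most \<open>n + O(1)\<close>, so if \<open>f (h n) \<ge> 2 n\<close> then \<open>X \<restriction> h n\<close> differs from it for
  all large \<open>n\<close>, and making \<open>\<psi>\<^sub>0\<close> undefined at small arguments preserves linear universality.

  For (2), let \<open>Z\<close> be the characteristic function of the graph of \<open>X\<close>. Let \<open>\<theta> x\<close>, for
  \<open>x = \<langle>a, b, \<tau>\<rangle>\<close>, be the value at \<open>a x + b\<close> of the function whose graph \<open>U \<tau>\<close> describes. If
  \<open>\<psi> (a x + b) = \<theta> x\<close> for all \<open>x\<close>, and \<open>X\<close> avoids \<open>\<psi>\<close>, then no \<open>\<tau>\<close> of length at most \<open>k\<close>
  describes a segment \<open>Z \<restriction> n\<close> that is long enough to determine \<open>X (a \<langle>a, b, \<tau>\<rangle> + b)\<close>. For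
  \<open>k \<ge> a, b\<close> such a length is computable from \<open>k\<close> alone, and \<open>g\<close> is its inverse.
\<close>

section \<open>Closure properties of recursive functions\<close>

text \<open>The flag \<open>b\<close> tells whether the oracle may be consulted.\<close>

definition rec_in :: "bool \<Rightarrow> nat \<Rightarrow> ((nat \<Rightarrow> nat) \<Rightarrow> nat list \<Rightarrow> nat) \<Rightarrow> bool" where
  "rec_in b n f \<longleftrightarrow>
     (\<exists>e. (b \<or> oracle_free e) \<and> (\<forall>X xs. length xs = n \<longrightarrow> run X e xs = Some (f X xs)))"

lemma rec_inI:
  assumes "b \<or> oracle_free e" "\<And>X xs. length xs = n \<Longrightarrow> run X e xs = Some (f X xs)"
  shows "rec_in b n f"
  using assms unfolding rec_in_def by blast

lemma rec_inE:
  assumes "rec_in b n f"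
  obtains e where "b \<or> oracle_free e" "\<And>X xs. length xs = n \<Longrightarrow> run X e xs = Some (f X xs)"
  using assms unfolding rec_in_def by blast

lemma rec_in_cong:
  assumes "rec_in b n f" "\<And>X xs. length xs = n \<Longrightarrow> f X xs = g X xs"
  shows "rec_in b n g"
  using assms unfolding rec_in_def by metis

lemma rec_in_mono: "rec_in False n f \<Longrightarrow> rec_in b n f"
  unfolding rec_in_def by blast

text \<open>\<open>partial_recursive\<close> speaks of one dummy oracle, \<open>rec_in\<close> of
  all oracles; this passes between them.\<close>

lemma run_oracle_free: "oracle_free e \<Longrightarrow> run X e xs = run Y e xs"
proof (induction e arbitrary: xs)
  case (Comp f gs)
  then have *: "map (\<lambda>g. run X g xs) gs = map (\<lambda>g. run Y g xs) gs" for xs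
    by (auto intro!: map_cong)
  show ?case using Comp.prems Comp.IH(1) by (simp add: * Let_def)
next
  case (PrimRec f g)
  then have "run X f = run Y f" "run X g = run Y g" by auto
  then show ?case by (simp split: list.split)
next
  case (Mu f)
  then have "run X f = run Y f" by auto
  then show ?case by simp
qed auto

lemma run_Comp_Some:
  assumes "list_all2 (\<lambda>g y. run X g xs = Some y) gs ys"
  shows "run X (Comp f gs) xs = run X f ys"
proof -
  have "map (\<lambda>g. run X g xs) gs = map Some ys"
    using assms by (induction rule: list_all2_induct) auto
  then show ?thesis by (simp add: Let_def comp_def image_iff)
qed

lemma rec_in_proj: "i < n \<Longrightarrow> rec_in b n (\<lambda>X xs. xs ! i)"
  by (rule rec_inI[of _ "Proj i"]) auto

lemma rec_in_proj_tl: "Suc i < n \<Longrightarrow> rec_in b n (\<lambda>X xs. tl xs ! i)"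
  by (rule rec_inI[of _ "Proj (Suc i)"]) (auto simp: nth_tl)

lemma rec_in_comp:
  assumes F: "rec_in b (length gs) F" and gs: "\<And>g. g \<in> set gs \<Longrightarrow> rec_in b n g"
  shows "rec_in b n (\<lambda>X xs. F X (map (\<lambda>g. g X xs) gs))"
proof -
  \<comment> \<open>A term is given for each member of \<open>gs\<close> separately; induction
    collects them into one list.\<close>
  have "\<exists>es. (b \<or> (\<forall>e\<in>set es. oracle_free e)) \<and>
             (\<forall>X xs. length xs = n \<longrightarrow> list_all2 (\<lambda>e y. run X e xs = Some y) es (map (\<lambda>g. g X xs) gs))"
    using gs
  proof (induction gs)
    case Nil
    show ?case by (rule exI[of _ "[]"]) simp
  next
    case (Cons g gs)
    then obtain es where es: "b \<or> (\<forall>e\<in>set es. oracle_free e)"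
      "\<forall>X xs. length xs = n \<longrightarrow> list_all2 (\<lambda>e y. run X e xs = Some y) es (map (\<lambda>g. g X xs) gs)"
      by auto
    from Cons.prems have "rec_in b n g" by simp
    then obtain e where "b \<or> oracle_free e" "\<And>X xs. length xs = n \<Longrightarrow> run X e xs = Some (g X xs)"
      by (rule rec_inE) blast
    with es show ?case by (intro exI[of _ "e # es"]) auto
  qed
  then obtain es where es: "b \<or> (\<forall>e\<in>set es. oracle_free e)"
    "\<And>X xs. length xs = n \<Longrightarrow> list_all2 (\<lambda>e y. run X e xs = Some y) es (map (\<lambda>g. g X xs) gs)"
    by blast
  obtain e where e: "b \<or> oracle_free e"
    "\<And>X xs. length xs = length gs \<Longrightarrow> run X e xs = Some (F X xs)"
    using F by (rule rec_inE) blast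
  show ?thesis
  proof (rule rec_inI[of _ "Comp e es"])
    show "b \<or> oracle_free (Comp e es)" using es(1) e(1) by auto
    show "run X (Comp e es) xs = Some (F X (map (\<lambda>g. g X xs) gs))" if "length xs = n" for X xs
      using run_Comp_Some[OF es(2)[OF that]] e(2) by simp
  qed
qed

lemma rec_in_comp1:
  assumes "rec_in False 1 (\<lambda>X xs. h (xs ! 0))" "rec_in b n f"
  shows "rec_in b n (\<lambda>X xs. h (f X xs))"
  using rec_in_comp[of b "[f]" "\<lambda>X xs. h (xs ! 0)" n] assms by (simp add: rec_in_mono)

lemma rec_in_comp2:
  assumes "rec_in False 2 (\<lambda>X xs. h (xs ! 0) (xs ! 1))" "rec_in b n f" "rec_in b n g"
  shows "rec_in b n (\<lambda>X xs. h (f X xs) (g X xs))"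
  using rec_in_comp[of b "[f, g]" "\<lambda>X xs. h (xs ! 0) (xs ! 1)" n] assms
  by (auto simp: rec_in_mono numeral_2_eq_2)

text \<open>Weakening by a leading argument, used once inside a search and twice inside a recursion,
  past the counter and the previous value.\<close>

lemma rec_in_tl:
  assumes "rec_in b n f"
  shows "rec_in b (Suc n) (\<lambda>X xs. f X (tl xs))"
proof -
  let ?ps = "map (\<lambda>i X xs. xs ! Suc i) [0..<n]"
  have "rec_in b (Suc n) (\<lambda>X xs. f X (map (\<lambda>g. g X xs) ?ps))"
    by (rule rec_in_comp) (use assms in \<open>auto intro!: rec_in_proj\<close>)
  then show ?thesis
  proof (rule rec_in_cong)
    fix X :: "nat \<Rightarrow> nat" and xs :: "nat list"
    assume "length xs = Suc n"
    then have "map (\<lambda>g. g X xs) ?ps = tl xs" by (auto intro!: nth_equalityI simp: nth_tl)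
    then show "f X (map (\<lambda>g. g X xs) ?ps) = f X (tl xs)" by simp
  qed
qed

lemma rec_in_Suc:
  assumes "rec_in b n f"
  shows "rec_in b n (\<lambda>X xs. Suc (f X xs))"
proof (rule rec_in_comp1[OF _ assms])
  show "rec_in False 1 (\<lambda>X xs. Suc (xs ! 0))"
    by (rule rec_inI[of _ Succ]) (auto split: list.split)
qed

lemma rec_in_const: "rec_in b n (\<lambda>X xs. c)"
proof (induction c)
  case 0
  show ?case by (rule rec_inI[of _ Zero]) auto
next
  case (Suc c)
  then show ?case by (rule rec_in_Suc)
qed

lemma rec_in_oracle:
  assumes "rec_in True n f"
  shows "rec_in True n (\<lambda>X xs. X (f X xs))"
proof -
  have "rec_in True (length [f]) (\<lambda>X xs. X (xs ! 0))"
    by (rule rec_inI[of _ Oracle]) (auto split: list.split)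
  from rec_in_comp[OF this, of n] show ?thesis using assms by simp
qed

lemma rec_in_primrec:
  assumes B: "rec_in b n B" and S: "rec_in b (Suc (Suc n)) (\<lambda>X ys. S X (ys ! 0) (ys ! 1) (tl (tl ys)))"
    and C: "rec_in b n C"
  shows "rec_in b n (\<lambda>X xs. rec_nat (B X xs) (\<lambda>k r. S X k r xs) (C X xs))"
proof -
  obtain eB where eB: "b \<or> oracle_free eB" "\<And>X xs. length xs = n \<Longrightarrow> run X eB xs = Some (B X xs)"
    using B by (rule rec_inE) blast
  obtain eS where eS: "b \<or> oracle_free eS"
    "\<And>X ys. length ys = Suc (Suc n) \<Longrightarrow> run X eS ys = Some (S X (ys ! 0) (ys ! 1) (tl (tl ys)))"
    using S by (rule rec_inE) blast
  have run: "run X (PrimRec eB eS) (m # xs) = Some (rec_nat (B X xs) (\<lambda>k r. S X k r xs) m)"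
    if "length xs = n" for X m xs
    by (induction m) (simp_all add: that eB(2) eS(2))
  have "rec_in b (Suc n) (\<lambda>X ys. rec_nat (B X (tl ys)) (\<lambda>k r. S X k r (tl ys)) (ys ! 0))"
  proof (rule rec_inI[of _ "PrimRec eB eS"])
    show "b \<or> oracle_free (PrimRec eB eS)" using eB(1) eS(1) by auto
    show "run X (PrimRec eB eS) ys =
        Some (rec_nat (B X (tl ys)) (\<lambda>k r. S X k r (tl ys)) (ys ! 0))"
      if "length ys = Suc n" for X ys
      using that run by (cases ys) (simp_all del: run.simps)
  qed
  \<comment> \<open>Composition with \<open>C\<close> and the \<open>n\<close> projections forms the
    argument list \<open>C X xs # xs\<close>.\<close>
  then have *: "rec_in b (length (C # map (\<lambda>i X xs. xs ! i) [0..<n]))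
                  (\<lambda>X ys. rec_nat (B X (tl ys)) (\<lambda>k r. S X k r (tl ys)) (ys ! 0))"
    by simp
  show ?thesis
  proof (rule rec_in_cong[OF rec_in_comp[OF *]])
    fix X :: "nat \<Rightarrow> nat" and xs :: "nat list"
    assume "length xs = n"
    then have "map ((\<lambda>g. g X xs) \<circ> (\<lambda>i X xs. xs ! i)) [0..<n] = xs"
      by (auto intro!: nth_equalityI)
    then show "rec_nat (B X (tl (map (\<lambda>g. g X xs) (C # map (\<lambda>i X xs. xs ! i) [0..<n]))))
        (\<lambda>k r. S X k r (tl (map (\<lambda>g. g X xs) (C # map (\<lambda>i X xs. xs ! i) [0..<n]))))
        (map (\<lambda>g. g X xs) (C # map (\<lambda>i X xs. xs ! i) [0..<n]) ! 0) =
      rec_nat (B X xs) (\<lambda>k r. S X k r xs) (C X xs)"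
      by simp
  qed (use C in \<open>auto intro!: rec_in_proj\<close>)
qed

text \<open>For a body that is defined at every candidate, the condition in the semantics of
  \<open>Mu\<close> just says that \<open>n\<close> is the first zero.\<close>

lemma run_Mu:
  assumes "\<And>v. run X e (v # xs) = Some (g v)"
  shows "run X (Mu e) xs = (if \<exists>v. g v = 0 then Some (LEAST v. g v = 0) else None)"
proof -
  define P where "P n \<longleftrightarrow> run X e (n # xs) = Some 0 \<and> (\<forall>m<n. \<exists>y>0. run X e (m # xs) = Some y)" for n
  have P: "P n \<longleftrightarrow> g n = 0 \<and> (\<forall>m<n. g m \<noteq> 0)" for n
    unfolding P_def by (simp add: assms)
  have run: "run X (Mu e) xs = (if \<exists>n. P n then Some (THE n. P n) else None)"
    by (simp add: P_def Let_def)
  show ?thesis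
  proof (cases "\<exists>v. g v = 0")
    case True
    have "P (LEAST v. g v = 0)"
      unfolding P using LeastI_ex[OF True] by (auto dest: not_less_Least)
    moreover have "n = (LEAST v. g v = 0)" if "P n" for n
    proof (rule Least_equality[symmetric])
      show "g n = 0" using that unfolding P by blast
      show "n \<le> m" if "g m = 0" for m
        using that \<open>P n\<close> unfolding P by (metis not_le)
    qed
    ultimately have "\<exists>n. P n" "(THE n. P n) = (LEAST v. g v = 0)" by (blast, rule the_equality)
    then show ?thesis unfolding run using True by simp
  next
    case False
    then have "\<nexists>n. P n" unfolding P by blast
    with False show ?thesis unfolding run by simp
  qed
qed

section \<open>Arithmetic and decidable predicates\<close>

lemma rec_in_add:
  assumes "rec_in b n f" "rec_in b n g"
  shows "rec_in b n (\<lambda>X xs. f X xs + g X xs)"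
proof -
  have "rec_in b n (\<lambda>X xs. rec_nat (f X xs) (\<lambda>k r. Suc r) (g X xs))"
    by (rule rec_in_primrec) (use assms in \<open>auto intro!: rec_in_Suc rec_in_proj\<close>)
  moreover have "rec_nat x (\<lambda>k r. Suc r) y = x + y" for x y by (induction y) auto
  ultimately show ?thesis by simp
qed

lemma rec_in_diff:
  assumes "rec_in b n f" "rec_in b n g"
  shows "rec_in b n (\<lambda>X xs. f X xs - g X xs)"
proof -
  have pred: "rec_in b m (\<lambda>X xs. h X xs - 1)" if "rec_in b m h" for m h
  proof -
    have "rec_in b m (\<lambda>X xs. rec_nat 0 (\<lambda>k r. k) (h X xs))"
      by (rule rec_in_primrec) (use that in \<open>auto intro!: rec_in_const rec_in_proj\<close>)
    moreover have "rec_nat 0 (\<lambda>k r. k) y = y - 1" for y by (cases y) auto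
    ultimately show ?thesis by simp
  qed
  have "rec_in b n (\<lambda>X xs. rec_nat (f X xs) (\<lambda>k r. r - 1) (g X xs))"
    by (intro rec_in_primrec pred rec_in_proj assms) simp
  moreover have "rec_nat x (\<lambda>k r. r - 1) y = x - y" for x y :: nat by (induction y) auto
  ultimately show ?thesis by simp
qed

lemma rec_in_mult:
  assumes "rec_in b n f" "rec_in b n g"
  shows "rec_in b n (\<lambda>X xs. f X xs * g X xs)"
proof -
  have "rec_in b n (\<lambda>X xs. rec_nat 0 (\<lambda>k r. r + f X xs) (g X xs))"
    by (rule rec_in_primrec)
      (use assms in \<open>auto intro!: rec_in_const rec_in_add rec_in_proj rec_in_tl[OF rec_in_tl]\<close>)
  moreover have "rec_nat 0 (\<lambda>k r. r + x) y = x * y" for x y :: nat by (induction y) auto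
  ultimately show ?thesis by simp
qed

lemma rec_in_power:
  assumes "rec_in b n f" "rec_in b n g"
  shows "rec_in b n (\<lambda>X xs. f X xs ^ g X xs)"
proof -
  have "rec_in b n (\<lambda>X xs. rec_nat 1 (\<lambda>k r. r * f X xs) (g X xs))"
    by (rule rec_in_primrec)
      (use assms in \<open>auto intro!: rec_in_const rec_in_mult rec_in_proj rec_in_tl[OF rec_in_tl]\<close>)
  moreover have "rec_nat 1 (\<lambda>k r. r * x) y = x ^ y" for x y :: nat by (induction y) auto
  ultimately show ?thesis by simp
qed

lemma rec_in_le:
  assumes "rec_in b n f" "rec_in b n g"
  shows "rec_in b n (\<lambda>X xs. of_bool (f X xs \<le> g X xs))"
proof -
  have "rec_in b n (\<lambda>X xs. 1 - (f X xs - g X xs))"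
    using assms by (intro rec_in_diff rec_in_const)
  then show ?thesis by (rule rec_in_cong) auto
qed

lemma rec_in_not:
  assumes "rec_in b n (\<lambda>X xs. of_bool (P X xs))"
  shows "rec_in b n (\<lambda>X xs. of_bool (\<not> P X xs))"
proof -
  have "rec_in b n (\<lambda>X xs. 1 - of_bool (P X xs))"
    using assms by (intro rec_in_diff rec_in_const)
  then show ?thesis by (rule rec_in_cong) auto
qed

lemma rec_in_conj:
  assumes "rec_in b n (\<lambda>X xs. of_bool (P X xs))" "rec_in b n (\<lambda>X xs. of_bool (Q X xs))"
  shows "rec_in b n (\<lambda>X xs. of_bool (P X xs \<and> Q X xs))"
  using rec_in_mult[OF assms] by (rule rec_in_cong) auto

lemma rec_in_disj:
  assumes "rec_in b n (\<lambda>X xs. of_bool (P X xs))" "rec_in b n (\<lambda>X xs. of_bool (Q X xs))"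
  shows "rec_in b n (\<lambda>X xs. of_bool (P X xs \<or> Q X xs))"
  using rec_in_not[OF rec_in_conj[OF assms[THEN rec_in_not]]] by simp

lemma rec_in_less:
  assumes "rec_in b n f" "rec_in b n g"
  shows "rec_in b n (\<lambda>X xs. of_bool (f X xs < g X xs))"
  using rec_in_not[OF rec_in_le[OF assms(2,1)]] by (simp add: not_le)

lemma rec_in_eq:
  assumes "rec_in b n f" "rec_in b n g"
  shows "rec_in b n (\<lambda>X xs. of_bool (f X xs = g X xs))"
  using rec_in_conj[OF rec_in_le[OF assms] rec_in_le[OF assms(2,1)]]
  by (rule rec_in_cong) auto

text \<open>\<open>Mu\<close> looks for a zero, so its body decides the negation of
  \<open>P\<close>; the assumption \<open>ex\<close> makes the search total.\<close>

lemma rec_in_Least: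
  assumes P: "rec_in b (Suc n) (\<lambda>X ys. of_bool (P X (ys ! 0) (tl ys)))"
    and ex: "\<And>X xs. length xs = n \<Longrightarrow> \<exists>v. P X v xs"
  shows "rec_in b n (\<lambda>X xs. LEAST v. P X v xs)"
proof -
  obtain e where e: "b \<or> oracle_free e"
    "\<And>X ys. length ys = Suc n \<Longrightarrow> run X e ys = Some (of_bool (\<not> P X (ys ! 0) (tl ys)))"
    using rec_in_not[OF P] by (rule rec_inE) blast
  have "run X (Mu e) xs = Some (LEAST v. P X v xs)" if "length xs = n" for X xs
    using run_Mu[of X e xs "\<lambda>v. of_bool (\<not> P X v xs)"] e(2)[of "_ # xs" X] ex[OF that] that
    by simp
  then show ?thesis using e(1) by (intro rec_inI[of _ "Mu e"]) auto
qed

text \<open>The disjunct \<open>y = 0\<close> ends the search at once for divisor 0, in agreement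
  with \<open>x div 0 = 0\<close>.\<close>

lemma Least_div: "(LEAST q. y = 0 \<or> x < Suc q * y) = x div (y :: nat)"
proof (rule Least_equality)
  show "y = 0 \<or> x < Suc (x div y) * y"
    using dividend_less_div_times[of y x] by auto
  show "x div y \<le> q" if "y = 0 \<or> x < Suc q * y" for q
  proof (cases "y = 0")
    case False
    with that have "x div y < Suc q" by (simp add: div_less_iff_less_mult del: mult_Suc)
    then show ?thesis by simp
  qed simp
qed

lemma rec_in_div:
  assumes "rec_in b n f" "rec_in b n g"
  shows "rec_in b n (\<lambda>X xs. f X xs div g X xs)"
proof -
  have "rec_in b n (\<lambda>X xs. LEAST q. g X xs = 0 \<or> f X xs < Suc q * g X xs)"
  proof (rule rec_in_Least)
    show "\<exists>q. g X xs = 0 \<or> f X xs < Suc q * g X xs" for X xs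
      using dividend_less_div_times[of "g X xs" "f X xs"] by (metis add.commute gr0I mult_Suc)
  qed (intro rec_in_disj rec_in_eq rec_in_less rec_in_mult rec_in_Suc rec_in_const
        rec_in_tl[OF assms(1)] rec_in_tl[OF assms(2)] rec_in_proj, simp)
  then show ?thesis unfolding Least_div .
qed

lemma rec_in_odd:
  assumes "rec_in b n f"
  shows "rec_in b n (\<lambda>X xs. of_bool (odd (f X xs)))"
proof -
  have "rec_in b n (\<lambda>X xs. f X xs - 2 * (f X xs div 2))"
    by (intro rec_in_diff rec_in_mult rec_in_div rec_in_const assms)
  moreover have "m - 2 * (m div 2) = of_bool (odd m)" for m :: nat
    by (simp add: minus_mult_div_eq_mod mod_2_eq_odd)
  ultimately show ?thesis by simp
qed

lemma Least_floor_sqrt: "(LEAST s. x < (Suc s)\<^sup>2) = floor_sqrt x"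
proof (rule Least_equality)
  show "x < (Suc (floor_sqrt x))\<^sup>2" by (rule Suc_floor_sqrt_power2_gt)
  show "floor_sqrt x \<le> s" if "x < (Suc s)\<^sup>2" for s
    using that floor_sqrt_power2_le[of x]
    by (metis le_less_trans less_Suc_eq_le power2_less_imp_less zero_le)
qed

lemma rec_in_floor_sqrt:
  assumes "rec_in b n f"
  shows "rec_in b n (\<lambda>X xs. floor_sqrt (f X xs))"
proof -
  have "rec_in b n (\<lambda>X xs. LEAST s. f X xs < (Suc s)\<^sup>2)"
  proof (rule rec_in_Least)
    show "\<exists>s. f X xs < (Suc s)\<^sup>2" for X xs
      using Suc_floor_sqrt_power2_gt by blast
  qed (intro rec_in_less rec_in_power rec_in_Suc rec_in_const rec_in_tl[OF assms] rec_in_proj, simp)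
  then show ?thesis by (simp add: Least_floor_sqrt)
qed

section \<open>A pairing function that is monotone in both arguments\<close>

definition pair :: "nat \<Rightarrow> nat \<Rightarrow> nat" where
  "pair i j = (i + j)\<^sup>2 + i"

definition pfst :: "nat \<Rightarrow> nat" where
  "pfst n = n - (floor_sqrt n)\<^sup>2"

definition psnd :: "nat \<Rightarrow> nat" where
  "psnd n = floor_sqrt n - pfst n"

text \<open>The remainder \<open>i\<close> is at most \<open>i + j\<close>, so the number stays
  below the next square.\<close>

lemma floor_sqrt_pair: "floor_sqrt (pair i j) = i + j"
  by (rule floor_sqrt_unique) (auto simp: pair_def power2_eq_square)

lemma pfst_pair [simp]: "pfst (pair i j) = i"
  unfolding pfst_def floor_sqrt_pair by (simp add: pair_def)

lemma psnd_pair [simp]: "psnd (pair i j) = j"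
  unfolding psnd_def floor_sqrt_pair by simp

lemma pair_mono: "i \<le> i' \<Longrightarrow> j \<le> j' \<Longrightarrow> pair i j \<le> pair i' j'"
  unfolding pair_def by (intro add_mono power_mono) auto

lemma rec_in_pair: "rec_in b n f \<Longrightarrow> rec_in b n g \<Longrightarrow> rec_in b n (\<lambda>X xs. pair (f X xs) (g X xs))"
  unfolding pair_def by (intro rec_in_add rec_in_power rec_in_const)

lemma rec_in_pfst: "rec_in b n f \<Longrightarrow> rec_in b n (\<lambda>X xs. pfst (f X xs))"
  unfolding pfst_def by (intro rec_in_diff rec_in_power rec_in_const rec_in_floor_sqrt)

lemma rec_in_psnd: "rec_in b n f \<Longrightarrow> rec_in b n (\<lambda>X xs. psnd (f X xs))"
  unfolding psnd_def by (intro rec_in_diff rec_in_pfst rec_in_floor_sqrt)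

lemmas rec_in_intros =
  rec_in_proj rec_in_proj_tl rec_in_const rec_in_Suc rec_in_oracle
  rec_in_add rec_in_diff rec_in_mult rec_in_power rec_in_div rec_in_odd
  rec_in_le rec_in_less rec_in_eq rec_in_not rec_in_conj rec_in_disj
  rec_in_pair rec_in_pfst rec_in_psnd

section \<open>Partial recursive functions, functionals and order functions\<close>

lemma rec_in_total_recursive2:
  assumes "rec_in False 2 (\<lambda>X xs. h (xs ! 0) (xs ! 1))"
  shows "total_recursive2 h"
  using assms unfolding rec_in_def total_recursive2_def by force

lemma total_recursive2_rec_in:
  assumes "total_recursive2 h"
  shows "rec_in False 2 (\<lambda>X xs. h (xs ! 0) (xs ! 1))"
proof -
  obtain e where e: "oracle_free e" "\<And>x y. run (\<lambda>_. 0) e [x, y] = Some (h x y)"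
    using assms unfolding total_recursive2_def by blast
  have "run X e [x, y] = Some (h x y)" for X x y
    using e run_oracle_free by metis
  then show ?thesis
    using e(1) by (intro rec_inI[of _ e]) (auto simp: length_Suc_conv numeral_2_eq_2)
qed

lemma partial_recursive_comp:
  assumes "partial_recursive \<theta>" "rec_in False 1 (\<lambda>X xs. f (xs ! 0))"
  shows "partial_recursive (\<lambda>x. \<theta> (f x))"
proof -
  obtain e where "oracle_free e" "\<And>x. \<theta> x = run (\<lambda>_. 0) e [x]"
    using assms(1) unfolding partial_recursive_def by blast
  moreover obtain d where "oracle_free d" "\<And>X xs. length xs = 1 \<Longrightarrow> run X d xs = Some (f (xs ! 0))"
    using rec_inE[OF assms(2)] by auto
  ultimately show ?thesis
    unfolding partial_recursive_def by (intro exI[of _ "Comp e [d]"]) auto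
qed

lemma partial_recursive_search:
  assumes "partial_recursive \<theta>" "rec_in False 2 (\<lambda>X xs. of_bool (P (xs ! 1) (xs ! 0)))"
  shows "partial_recursive (\<lambda>x. if \<exists>v. P x v then \<theta> (LEAST v. P x v) else None)"
proof -
  obtain e where e: "oracle_free e" "\<And>x. \<theta> x = run (\<lambda>_. 0) e [x]"
    using assms(1) unfolding partial_recursive_def by blast
  obtain d where d: "oracle_free d"
    "\<And>X xs. length xs = 2 \<Longrightarrow> run X d xs = Some (of_bool (\<not> P (xs ! 1) (xs ! 0)))"
    using rec_inE[OF rec_in_not[OF assms(2)]] by auto
  have "run X (Mu d) [x] = (if \<exists>v. P x v then Some (LEAST v. P x v) else None)" for X x
    using run_Mu[of X d "[x]" "\<lambda>v. of_bool (\<not> P x v)"] d(2)[of "[_, x]" X] by simp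
  then show ?thesis
    unfolding partial_recursive_def using e d(1)
    by (intro exI[of _ "Comp e [Mu d]"]) (auto simp: Let_def simp del: run.simps(7))
qed

text \<open>The search runs after the evaluation and has its value \<open>s\<close> as a parameter;
  it serves to read a number off a string described by a machine.\<close>

lemma partial_recursive_search_in:
  assumes "partial_recursive \<theta>" "rec_in False 3 (\<lambda>X xs. of_bool (P (xs ! 2) (xs ! 1) (xs ! 0)))"
  shows "partial_recursive (\<lambda>x. case \<theta> x of None \<Rightarrow> None
           | Some s \<Rightarrow> if \<exists>v. P x s v then Some (LEAST v. P x s v) else None)"
proof -
  obtain e where e: "oracle_free e" "\<And>x. \<theta> x = run (\<lambda>_. 0) e [x]"
    using assms(1) unfolding partial_recursive_def by blast
  obtain d where d: "oracle_free d"
    "\<And>X xs. length xs = 3 \<Longrightarrow> run X d xs = Some (of_bool (\<not> P (xs ! 2) (xs ! 1) (xs ! 0)))"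
    using rec_inE[OF rec_in_not[OF assms(2)]] by auto
  have "run X (Mu d) [s, x] = (if \<exists>v. P x s v then Some (LEAST v. P x s v) else None)" for X s x
    using run_Mu[of X d "[s, x]" "\<lambda>v. of_bool (\<not> P x s v)"] d(2)[of "[_, s, x]" X] by simp
  then show ?thesis
    unfolding partial_recursive_def using e d(1)
    by (intro exI[of _ "Comp (Mu d) [e, Proj 0]"])
      (auto simp: Let_def split: option.split simp del: run.simps(7))
qed

lemma partial_recursive_restrict:
  assumes "partial_recursive \<theta>"
  shows "partial_recursive (\<lambda>x. if N \<le> x then \<theta> x else None)"
proof -
  \<comment> \<open>The search finds \<open>x\<close> itself if \<open>N \<le> x\<close> and
    diverges otherwise, which cuts down the domain.\<close>
  have "partial_recursive (\<lambda>x. if \<exists>v. v = x \<and> N \<le> x then \<theta> (LEAST v. v = x \<and> N \<le> x) else None)"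
    by (rule partial_recursive_search[OF assms]) (intro rec_in_intros; simp)
  moreover have "(LEAST v. v = x \<and> N \<le> x) = x" if "N \<le> x" for x
    by (rule Least_equality) (use that in auto)
  ultimately show ?thesis by (simp cong: if_cong)
qed

lemma strongly_reducibleI:
  assumes "rec_in True 1 (\<lambda>X xs. F X (xs ! 0))" "\<And>X. X \<in> Q \<Longrightarrow> F X \<in> P"
  shows "P \<le>\<^sub>s Q"
proof -
  obtain e where e: "\<And>X xs. length xs = 1 \<Longrightarrow> run X e xs = Some (F X (xs ! 0))"
    using assms(1) by (rule rec_inE) blast
  then have "partial_recursive_functional (\<lambda>X. Some (F X))"
    unfolding partial_recursive_functional_def by (intro exI[of _ e]) auto
  then show ?thesis
    unfolding strongly_reducible_def using assms(2) by blast
qed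

text \<open>A natural number is its own approximation, with subtrahend 0, denominator 1 and error
  0.\<close>

lemma order_function_of_nat:
  assumes "rec_in False 1 (\<lambda>X xs. h (xs ! 0))" "mono h" "\<And>B. \<exists>n. B < h n"
  shows "order_function (\<lambda>n. real (h n))"
  unfolding order_function_def
proof (intro conjI allI)
  have "total_recursive2 (\<lambda>n k. h n)"
    by (rule rec_in_total_recursive2) (rule rec_in_comp1[OF assms(1)], rule rec_in_proj, simp)
  moreover have "total_recursive2 (\<lambda>n k. 0)"
    by (rule rec_in_total_recursive2) (rule rec_in_const)
  ultimately show "computable_real_fun (\<lambda>n. real (h n))"
    unfolding computable_real_fun_def
    by (intro exI[of _ "\<lambda>n k. h n"] exI[of _ "\<lambda>n k. 0"]) auto
  show "mono (\<lambda>n. real (h n))" using assms(2) by (auto simp: mono_def)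
  fix B :: real
  obtain n where "nat \<lceil>B\<rceil> < h n" using assms(3) by blast
  then have "B < real (h n)" by linarith
  then show "\<exists>n. B < real (h n)" by blast
qed

section \<open>Binary strings and universal prefix-free machines\<close>

lemma str_code_append: "str_code (\<sigma> @ \<tau>) = str_code \<sigma> + 2 ^ length \<sigma> * str_code \<tau>"
  by (induction \<sigma>) (auto simp: algebra_simps)

lemma str_code_less: "str_code \<sigma> + 1 < 2 ^ Suc (length \<sigma>)"
  by (induction \<sigma>) auto

text \<open>\<open>str_code \<sigma> + 1\<close> is the ordinary binary number with the digits of
  \<open>\<sigma>\<close>, lowest first, below an additional leading 1.\<close>

lemma str_code_bit:
  "i < length \<sigma> \<Longrightarrow> odd ((str_code \<sigma> + 1) div 2 ^ i) \<longleftrightarrow> \<sigma> ! i"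
proof (induction \<sigma> arbitrary: i)
  case (Cons b \<sigma>)
  show ?case
  proof (cases i)
    case 0
    then show ?thesis by simp
  next
    case (Suc j)
    have "(str_code (b # \<sigma>) + 1) div 2 ^ i = (str_code (b # \<sigma>) + 1) div 2 div 2 ^ j"
      by (simp add: Suc div_mult2_eq)
    also have "(str_code (b # \<sigma>) + 1) div 2 = str_code \<sigma> + 1" by simp
    finally show ?thesis using Cons Suc by simp
  qed
qed simp

text \<open>The strings 0^x 1 are a prefix-free unary coding of the natural numbers; the closed form
  lets \<open>x\<close> be recovered from the code.\<close>

lemma str_code_replicate_False: "str_code (replicate x False @ [True]) + 1 = 3 * 2 ^ x"
  by (induction x) auto

text \<open>Appending bit \<open>i\<close> adds \<open>2 ^ i\<close> times the digit 1 or 2. In this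
  form the code is visibly recursive in the oracle \<open>X\<close>.\<close>

lemma str_code_initial_segment:
  "str_code (initial_segment X m) = rec_nat 0 (\<lambda>i r. r + 2 ^ i * (1 + of_bool (X i = 1))) m"
  by (induction m) (auto simp: initial_segment_def str_code_append)

lemma str_code_inv: "str_code \<circ> inv str_code = id"
  using bij_is_surj[OF bij_str_code] by (simp only: surj_iff)

lemma prefix_free_machineI:
  assumes \<theta>: "partial_recursive \<theta>"
    and prefix_free: "\<And>\<sigma> \<tau>. \<theta> (str_code \<sigma>) \<noteq> None \<Longrightarrow> \<theta> (str_code \<tau>) \<noteq> None \<Longrightarrow> prefix \<sigma> \<tau> \<Longrightarrow> \<sigma> = \<tau>"
  shows "prefix_free_machine (\<lambda>\<sigma>. map_option (inv str_code) (\<theta> (str_code \<sigma>)))"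
proof -
  show ?thesis
    unfolding prefix_free_machine_def using assms str_code_inv
    by (intro conjI exI[of _ \<theta>]) (auto simp: option.map_comp option.map_id dom_def)
qed

text \<open>The machine that answers \<open>\<theta> x\<close> on 0^x 1 and diverges on all other
  strings is prefix-free, so \<open>U\<close> simulates it behind a fixed prefix. Thus
  \<open>\<theta> x\<close>, if defined, has a description of length x + O(1).\<close>

lemma universal_simulates:
  assumes U: "universal_prefix_free_machine U" and \<theta>: "partial_recursive \<theta>"
  obtains \<rho> where "\<And>x. map_option str_code (U (\<rho> @ replicate x False @ [True])) = \<theta> x"
proof -
  define \<theta>' where "\<theta>' k = (if \<exists>x. 3 * 2 ^ x = Suc k then \<theta> (LEAST x. 3 * 2 ^ x = Suc k) else None)" for k
  have code: "\<theta>' (str_code (replicate x False @ [True])) = \<theta> x" for x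
  proof -
    have "(LEAST y. 3 * 2 ^ y = 3 * (2::nat) ^ x) = x" by (rule Least_equality) auto
    then show ?thesis
      using str_code_replicate_False[of x] unfolding \<theta>'_def by auto
  qed
  have dom: "\<exists>x. \<sigma> = replicate x False @ [True]" if dom: "\<theta>' (str_code \<sigma>) \<noteq> None" for \<sigma>
  proof -
    from dom obtain x where "3 * 2 ^ x = Suc (str_code \<sigma>)"
      unfolding \<theta>'_def by (auto split: if_splits)
    then have "str_code \<sigma> = str_code (replicate x False @ [True])"
      using str_code_replicate_False[of x] by simp
    then show ?thesis using bij_str_code by (metis bij_is_inj inj_eq)
  qed
  have "partial_recursive \<theta>'"
    unfolding \<theta>'_def
    by (rule partial_recursive_search[OF \<theta>]) (intro rec_in_intros; simp)
  moreover have "\<sigma> = \<tau>"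
    if \<sigma>: "\<theta>' (str_code \<sigma>) \<noteq> None" and \<tau>: "\<theta>' (str_code \<tau>) \<noteq> None" and pre: "prefix \<sigma> \<tau>" for \<sigma> \<tau>
  proof -
    obtain x y where xy: "\<sigma> = replicate x False @ [True]" "\<tau> = replicate y False @ [True]"
      using dom[OF \<sigma>] dom[OF \<tau>] by blast
    obtain \<upsilon> where "\<tau> = \<sigma> @ \<upsilon>" using pre by (auto simp: prefix_def)
    \<comment> \<open>Position \<open>x\<close> carries the last bit of \<open>\<sigma>\<close>,
      which is True, and the only True in \<open>\<tau>\<close> is at \<open>y\<close>; hence
      \<open>x = y\<close>.\<close>
    then have "\<tau> ! x" "x \<le> y"
      using xy by (auto simp: nth_append dest: arg_cong[where f = length])
    then show ?thesis using xy by (auto simp: nth_append split: if_splits)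
  qed
  ultimately have "prefix_free_machine (\<lambda>\<sigma>. map_option (inv str_code) (\<theta>' (str_code \<sigma>)))"
    by (rule prefix_free_machineI)
  then obtain \<rho> where \<rho>: "\<And>\<tau>. U (\<rho> @ \<tau>) = map_option (inv str_code) (\<theta>' (str_code \<tau>))"
    using U unfolding universal_prefix_free_machine_def by blast
  from \<rho> code have "map_option str_code (U (\<rho> @ replicate x False @ [True])) = \<theta> x" for x
    by (simp add: option.map_comp option.map_id str_code_inv)
  then show thesis by (rule that)
qed

text \<open>\<open>U\<close> simulates a constant function with value
  \<open>str_code \<sigma>\<close>. Hence the \<open>LEAST\<close> in \<open>K\<close> never ranges
  over an empty set.\<close>

lemma universal_describes:
  assumes "universal_prefix_free_machine U"
  obtains \<tau> where "U \<tau> = Some \<sigma>"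
proof -
  have "partial_recursive (\<lambda>x. Some (str_code \<sigma>))"
    using rec_inE[OF rec_in_const[of False 1 "str_code \<sigma>"]]
    unfolding partial_recursive_def by (metis One_nat_def length_Cons list.size(3))
  then obtain \<rho> where "\<And>x. map_option str_code (U (\<rho> @ replicate x False @ [True])) = Some (str_code \<sigma>)"
    using universal_simulates[OF assms] by blast
  then obtain \<tau> \<sigma>' where "U \<tau> = Some \<sigma>'" "str_code \<sigma>' = str_code \<sigma>" by blast
  then show thesis using that bij_str_code by (metis bij_is_inj inj_eq)
qed

lemma K_le: "U \<tau> = Some \<sigma> \<Longrightarrow> K U \<sigma> \<le> length \<tau>"
  unfolding K_def by (rule Least_le) blast

lemma K_attained:
  assumes "universal_prefix_free_machine U"
  obtains \<tau> where "U \<tau> = Some \<sigma>" "length \<tau> = K U \<sigma>"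
proof -
  have "\<exists>k \<tau>. length \<tau> = k \<and> U \<tau> = Some \<sigma>"
    using universal_describes[OF assms, of \<sigma>] by blast
  from LeastI_ex[OF this] show thesis
    using that unfolding K_def by blast
qed

lemma universal_code:
  assumes "universal_prefix_free_machine U"
  obtains \<upsilon> where "partial_recursive \<upsilon>" "\<And>\<sigma>. \<upsilon> (str_code \<sigma>) = map_option str_code (U \<sigma>)"
  using assms unfolding universal_prefix_free_machine_def prefix_free_machine_def by blast

section \<open>A linearly universal function\<close>

text \<open>The 2-adic valuation; the disjunct for quotient 0 ends the search at
  \<open>n = 0\<close>.\<close>

definition val2 :: "nat \<Rightarrow> nat" where
  "val2 n = (LEAST e. n div 2 ^ e = 0 \<or> odd (n div 2 ^ e))"

lemma val2_power2_mult_odd [simp]: "val2 (2 ^ e * (2 * x + 1)) = e"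
  unfolding val2_def
proof (rule Least_equality)
  fix d
  assume d: "2 ^ e * (2 * x + 1) div 2 ^ d = 0 \<or> odd (2 ^ e * (2 * x + 1) div 2 ^ d)"
  show "e \<le> d"
  proof (rule ccontr)
    assume "\<not> e \<le> d"
    then obtain i where "e = d + Suc i" using less_imp_Suc_add not_le by (metis add_Suc_right)
    then have "2 ^ e * (2 * x + 1) div 2 ^ d = 2 * (2 ^ i * (2 * x + 1))"
      by (simp add: power_add mult.assoc mult.left_commute)
    then show False using d by simp
  qed
qed simp

lemma rec_in_val2:
  assumes "rec_in b n f"
  shows "rec_in b n (\<lambda>X xs. val2 (f X xs))"
proof (rule rec_in_comp1[OF _ assms])
  have "\<exists>e. n div 2 ^ e = 0 \<or> odd (n div 2 ^ e)" for n :: nat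
    by (intro exI[of _ n] disjI1 div_less less_exp)
  then show "rec_in False 1 (\<lambda>X xs. val2 (xs ! 0))"
    unfolding val2_def by (intro rec_in_Least rec_in_intros) auto
qed

lemma universal_linearly:
  assumes U: "universal_prefix_free_machine U"
  obtains \<psi> where "partial_recursive \<psi>"
    "\<And>\<theta>. partial_recursive \<theta> \<Longrightarrow> \<exists>a b. 0 < a \<and> (\<forall>x. \<psi> (a * x + b) = \<theta> x)"
proof -
  obtain \<upsilon> where \<upsilon>: "partial_recursive \<upsilon>" "\<And>\<sigma>. \<upsilon> (str_code \<sigma>) = map_option str_code (U \<sigma>)"
    using universal_code[OF U] by blast
  \<comment> \<open>For \<open>n = 2 ^ e * (2 * x + 1)\<close>, the exponent \<open>e\<close> holds
    the code and the length of a prefix, and \<open>\<upsilon>\<close> is applied to the code of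
    that prefix followed by 0^x 1. Where \<open>e\<close> codes no prefix, the value is
    irrelevant.\<close>
  define \<psi> where
    "\<psi> n = \<upsilon> (pfst (val2 n) + 2 ^ psnd (val2 n) * (3 * 2 ^ (n div 2 ^ Suc (val2 n)) - 1))" for n
  have "partial_recursive \<psi>"
    unfolding \<psi>_def
    by (rule partial_recursive_comp[OF \<upsilon>(1)]) (intro rec_in_intros rec_in_val2; simp)
  moreover have "\<exists>a b. 0 < a \<and> (\<forall>x. \<psi> (a * x + b) = \<theta> x)" if \<theta>: "partial_recursive \<theta>" for \<theta>
  proof -
    obtain \<rho> where \<rho>: "\<And>x. map_option str_code (U (\<rho> @ replicate x False @ [True])) = \<theta> x"
      using universal_simulates[OF U \<theta>] by blast
    define e where "e = pair (str_code \<rho>) (length \<rho>)"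
    have "\<psi> (2 ^ Suc e * x + 2 ^ e) = \<theta> x" for x
    proof -
      have n: "2 ^ Suc e * x + 2 ^ e = 2 ^ e * (2 * x + 1)" by simp
      have val: "val2 (2 ^ Suc e * x + 2 ^ e) = e" unfolding n by (rule val2_power2_mult_odd)
      have div: "(2 ^ Suc e * x + 2 ^ e) div 2 ^ Suc e = x" by simp
      have "3 * 2 ^ x - 1 = str_code (replicate x False @ [True])"
        using str_code_replicate_False[of x] by simp
      then have "\<psi> (2 ^ Suc e * x + 2 ^ e) = \<upsilon> (str_code (\<rho> @ replicate x False @ [True]))"
        unfolding \<psi>_def val div str_code_append[of \<rho>] by (simp add: e_def)
      then show ?thesis using \<upsilon>(2) \<rho> by simp
    qed
    then show ?thesis by (intro exI[of _ "2 ^ Suc e"] exI[of _ "2 ^ e"]) simp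
  qed
  ultimately show thesis by (rule that)
qed

text \<open>Simulate \<open>\<theta>\<close> with its argument delayed by \<open>N\<close> and use
  the progression from \<open>x + N\<close> on: \<open>a * (x + N) + b\<close> is at least
  \<open>N\<close> because \<open>0 < a\<close>.\<close>

lemma linearly_universal_restrict:
  assumes \<psi>: "partial_recursive \<psi>"
    "\<And>\<theta>. partial_recursive \<theta> \<Longrightarrow> \<exists>a b. 0 < a \<and> (\<forall>x. \<psi> (a * x + b) = \<theta> x)"
  shows "linearly_universal (\<lambda>n. if N \<le> n then \<psi> n else None)"
  unfolding linearly_universal_def
proof (intro conjI allI impI)
  show "partial_recursive (\<lambda>n. if N \<le> n then \<psi> n else None)"
    by (rule partial_recursive_restrict[OF \<psi>(1)])
  fix \<theta>
  assume "partial_recursive \<theta>"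
  then have "partial_recursive (\<lambda>x. \<theta> (x - N))"
    by (rule partial_recursive_comp) (intro rec_in_intros; simp)
  then obtain a b where a: "0 < a" and ab: "\<And>x. \<psi> (a * x + b) = \<theta> (x - N)"
    using \<psi>(2) by blast
  have "\<psi> (a * x + (a * N + b)) = \<theta> x" for x
    using ab[of "x + N"] by (simp add: algebra_simps)
  moreover have "N \<le> a * x + (a * N + b)" for x
    using a by (metis add.commute mult_le_mono1 nat_mult_1 One_nat_def Suc_leI trans_le_add1 trans_le_add2)
  ultimately show "\<exists>a b. \<forall>x. (if N \<le> a * x + b then \<psi> (a * x + b) else None) = \<theta> x"
    by (intro exI[of _ a] exI[of _ "a * N + b"]) simp
qed

section \<open>The two reductions\<close>

text \<open>\<open>X\<close> is sent to the codes of its segments of length \<open>h n\<close>. The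
  constant in \<open>COMPLEX\<close> affects the linearly universal function that is avoided, but
  neither the functional nor \<open>q\<close>.\<close>

lemma LUA_reducible_COMPLEX:
  fixes f :: "nat \<Rightarrow> real"
  assumes U: "universal_prefix_free_machine U" and f: "order_function f"
  shows "\<exists>q. order_function q \<and> fast_growing q \<and> LUA q \<le>\<^sub>s COMPLEX U f"
proof -
  obtain a b c where abc: "total_recursive2 a" "total_recursive2 b" "total_recursive2 c"
    and approx: "\<And>n k. \<bar>f n - (real (a n k) - real (b n k)) / (real (c n k) + 1)\<bar> \<le> 1 / 2 ^ k"
    using f unfolding order_function_def computable_real_fun_def by blast
  \<comment> \<open>Cleared of denominators: the approximation of \<open>f m\<close> with error at
    most 1 is at least \<open>2 * n + 1\<close>. This is decidable, implies
    \<open>f m \<ge> 2 * n\<close>, and holds once \<open>f m > 2 * n + 2\<close>.\<close>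
  define P where "P n m \<longleftrightarrow> b m 0 + (2 * n + 1) * (c m 0 + 1) \<le> a m 0" for n m
  have P_iff: "P n m \<longleftrightarrow> real (2 * n + 1) \<le> (real (a m 0) - real (b m 0)) / (real (c m 0) + 1)" for n m
  proof -
    have "P n m \<longleftrightarrow> real (b m 0 + (2 * n + 1) * (c m 0 + 1)) \<le> real (a m 0)"
      unfolding P_def of_nat_le_iff ..
    also have "\<dots> \<longleftrightarrow> real (2 * n + 1) * (real (c m 0) + 1) \<le> real (a m 0) - real (b m 0)"
      by (simp add: algebra_simps)
    also have "\<dots> \<longleftrightarrow> real (2 * n + 1) \<le> (real (a m 0) - real (b m 0)) / (real (c m 0) + 1)"
      by (rule pos_le_divide_eq[symmetric]) linarith
    finally show ?thesis .
  qed
  have ex: "\<exists>m. P n m" for n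
  proof -
    obtain m where "f m > real (2 * n + 2)" using f unfolding order_function_def by blast
    then have "P n m" unfolding P_iff using approx[of m 0] by (simp add: abs_le_iff)
    then show ?thesis ..
  qed
  define h where "h n = (LEAST m. P n m)" for n
  have P_h: "P n (h n)" for n unfolding h_def using ex by (rule LeastI_ex)
  have f_h: "real (2 * n) \<le> f (h n)" for n
    using P_h[of n] approx[of "h n" 0] unfolding P_iff by (simp add: abs_le_iff)
  have "mono h"
  proof (rule monoI)
    fix i j :: nat
    assume "i \<le> j"
    then have "real (2 * i + 1) \<le> real (2 * j + 1)" by simp
    then have "P i (h j)" using P_h[of j] unfolding P_iff by (rule order_trans)
    then show "h i \<le> h j" unfolding h_def[of i] by (rule Least_le)
  qed
  have rec_h: "rec_in d n (\<lambda>X xs. h (F X xs))" if "rec_in d n F" for d n F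
  proof (rule rec_in_comp1[OF _ that])
    show "rec_in False 1 (\<lambda>X xs. h (xs ! 0))"
      unfolding h_def
    proof (rule rec_in_Least)
      show "rec_in False (Suc 1) (\<lambda>X xs. of_bool (P (tl xs ! 0) (xs ! 0)))"
        unfolding P_def
        by (intro rec_in_intros abc[THEN total_recursive2_rec_in, THEN rec_in_comp2]; simp)
    qed (rule ex)
  qed
  \<comment> \<open>Strings of length \<open>h n\<close> have codes below
    \<open>2 ^ (h n + 1)\<close>; the summand \<open>n\<close> brings the inverses below a geometric
    series.\<close>
  define q where "q n = (2::nat) ^ (h n + n + 2)" for n
  have "rec_in False 1 (\<lambda>X xs. q (xs ! 0))"
    unfolding q_def by (intro rec_in_intros rec_h; simp)
  moreover have "mono q"
    unfolding q_def
    by (intro monoI power_increasing add_mono monoD[OF \<open>mono h\<close>]) simp_all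
  moreover have "\<exists>n. B < q n" for B
  proof
    have "B < 2 ^ B" by (rule less_exp)
    also have "\<dots> \<le> q B" unfolding q_def by (rule power_increasing) auto
    finally show "B < q B" .
  qed
  ultimately have "order_function (\<lambda>n. real (q n))" by (rule order_function_of_nat)
  moreover have "fast_growing (\<lambda>n. real (q n))"
    unfolding fast_growing_def
  proof (intro conjI allI)
    show "1 < real (q n)" for n
      unfolding q_def of_nat_power by (rule one_less_power) simp_all
    show "summable (\<lambda>n. inverse (real (q n)))"
    proof (rule summable_comparison_test')
      show "summable (\<lambda>n. (1 / 2 :: real) ^ n)" by (rule summable_geometric) simp
      fix n :: nat
      have "(2::real) ^ n \<le> 2 ^ (h n + n + 2)" by (rule power_increasing) auto
      then show "norm (inverse (real (q n))) \<le> (1 / 2) ^ n"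
        unfolding q_def by (simp add: power_one_over inverse_eq_divide frac_le)
    qed
  qed
  moreover have "LUA (\<lambda>n. real (q n)) \<le>\<^sub>s COMPLEX U f"
  proof (rule strongly_reducibleI)
    show "rec_in True 1 (\<lambda>X xs. str_code (initial_segment X (h (xs ! 0))))"
      unfolding str_code_initial_segment
      by (intro rec_in_primrec rec_in_intros rec_h; simp)
    fix X
    assume "X \<in> COMPLEX U f"
    then obtain k :: nat where k: "\<And>n. real (K U (initial_segment X n)) \<ge> f n - real k"
      unfolding COMPLEX_def by blast
    obtain \<psi> where \<psi>: "partial_recursive \<psi>"
      "\<And>\<theta>. partial_recursive \<theta> \<Longrightarrow> \<exists>a b. 0 < a \<and> (\<forall>x. \<psi> (a * x + b) = \<theta> x)"
      using universal_linearly[OF U] by blast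
    obtain \<rho> where \<rho>: "\<And>x. map_option str_code (U (\<rho> @ replicate x False @ [True])) = \<psi> x"
      using universal_simulates[OF U \<psi>(1)] by blast
    \<comment> \<open>A coincidence at \<open>n\<close> gives
      \<open>2 * n - k \<le> length \<rho> + n + 1\<close>, so it occurs below
      \<open>N\<close>.\<close>
    define N where "N = length \<rho> + k + 2"
    have "\<psi> n \<noteq> Some (str_code (initial_segment X (h n)))" if "N \<le> n" for n
    proof
      assume "\<psi> n = Some (str_code (initial_segment X (h n)))"
      then have "U (\<rho> @ replicate n False @ [True]) = Some (initial_segment X (h n))"
        using \<rho>[of n] bij_str_code by (auto simp: bij_def inj_eq)
      then have "K U (initial_segment X (h n)) \<le> length \<rho> + n + 1"
        using K_le by fastforce
      moreover have "real (2 * n) - real k \<le> real (K U (initial_segment X (h n)))"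
        using k[of "h n"] f_h[of n] by linarith
      ultimately have "real (2 * n) \<le> real (length \<rho> + n + 1 + k)" by linarith
      then show False using that unfolding N_def by simp
    qed
    moreover have "str_code (initial_segment X (h n)) < q n" for n
    proof -
      have "str_code (initial_segment X (h n)) < 2 ^ Suc (h n)"
        using str_code_less[of "initial_segment X (h n)"] by (simp add: initial_segment_def)
      also have "\<dots> \<le> q n" unfolding q_def by (rule power_increasing) auto
      finally show ?thesis .
    qed
    moreover have "linearly_universal (\<lambda>n. if N \<le> n then \<psi> n else None)"
      using \<psi> by (rule linearly_universal_restrict)
    ultimately show "(\<lambda>n. str_code (initial_segment X (h n))) \<in> LUA (\<lambda>n. real (q n))"
      unfolding LUA_def
      by (auto intro!: exI[of _ "\<lambda>n. if N \<le> n then \<psi> n else None"] split: if_splits)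
  qed
  ultimately show ?thesis by blast
qed

text \<open>As \<open>p\<close> bounds the values of \<open>X\<close>, it is computable which length
  of the coded graph determines a given value; this keeps \<open>g\<close> recursive.\<close>

lemma COMPLEX_reducible_LUA:
  fixes p :: "nat \<Rightarrow> real"
  assumes U: "universal_prefix_free_machine U" and p: "order_function p"
  shows "\<exists>g. order_function g \<and> sub_identical g \<and> COMPLEX U g \<le>\<^sub>s LUA p"
proof -
  obtain a b c where a: "total_recursive2 a"
    and approx: "\<And>n k. \<bar>p n - (real (a n k) - real (b n k)) / (real (c n k) + 1)\<bar> \<le> 1 / 2 ^ k"
    using p unfolding order_function_def computable_real_fun_def by blast
  \<comment> \<open>Dropping the subtrahend and the denominator from the approximation with error 1
    leaves a recursive natural bound.\<close>
  have p_le: "p n \<le> real (a n 0 + 1)" for n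
  proof -
    have "(real (a n 0) - real (b n 0)) / (real (c n 0) + 1) \<le> real (a n 0) / (real (c n 0) + 1)"
      by (rule divide_right_mono) auto
    also have "\<dots> \<le> real (a n 0) / 1" by (rule divide_left_mono) auto
    finally show ?thesis using approx[of n 0] by (simp add: abs_le_iff)
  qed
  have "mono p" using p unfolding order_function_def by blast

  \<comment> \<open>Bounds \<open>A * x + B\<close> for
    \<open>x = pair A (pair B (str_code \<tau>))\<close> when \<open>A\<close>, \<open>B\<close> and
    \<open>length \<tau>\<close> are at most \<open>k\<close>.\<close>
  define J where "J k = k * pair k (pair k (2 ^ Suc k)) + k" for k
  \<comment> \<open>The last summand covers every position to be read. Summation makes
    \<open>L\<close> monotone, and the 2 in each summand yields
    \<open>2 * g n \<le> n\<close>.\<close>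
  define L where "L k = rec_nat 0 (\<lambda>i r. r + (pair (J i) (a (J i) 0 + 1) + 2)) (Suc k)" for k
  have L_ge: "pair (J k) (a (J k) 0 + 1) < L k" for k unfolding L_def by simp
  have L_mono: "mono L" unfolding L_def by (rule monoI, rule lift_Suc_mono_le) auto
  have L_lower: "2 * Suc k \<le> L k" for k unfolding L_def by (induction k) auto

  define g where "g n = (LEAST k. n < L k)" for n
  have ex: "\<exists>k. n < L k" for n
    using L_lower[of n] by (intro exI[of _ n]) simp
  have less_L_g: "n < L (g n)" for n unfolding g_def using ex by (rule LeastI_ex)
  have L_le: "L k \<le> n" if "k < g n" for k n
    using not_less_Least[OF that[unfolded g_def]] by simp
  have "rec_in False 1 (\<lambda>X xs. g (xs ! 0))"
    unfolding g_def
  proof (rule rec_in_Least)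
    show "rec_in False (Suc 1) (\<lambda>X xs. of_bool (tl xs ! 0 < L (xs ! 0)))"
      unfolding L_def J_def
      by (intro rec_in_primrec rec_in_intros rec_in_comp2[OF total_recursive2_rec_in[OF a]]; simp)
  qed (rule ex)
  moreover have "mono g"
  proof (rule monoI)
    fix i j :: nat
    assume "i \<le> j"
    then have "i < L (g j)" using less_L_g[of j] by simp
    then show "g i \<le> g j" unfolding g_def[of i] by (rule Least_le)
  qed
  moreover have "\<exists>n. B < g n" for B
  proof
    show "B < g (L B)" using less_L_g[of "L B"] L_mono by (metis leI monoD not_le)
  qed
  ultimately have "order_function (\<lambda>n. real (g n))" by (rule order_function_of_nat)
  moreover have "sub_identical (\<lambda>n. real (g n))"
    unfolding sub_identical_def
  proof (intro conjI allI)
    have "2 * g n \<le> n" for n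
      using L_le[of "g n - 1" n] L_lower[of "g n - 1"] by (cases "g n") auto
    then have "real (2 * g n) \<le> real n" for n by (simp only: of_nat_le_iff)
    then have half: "real n / 2 \<le> real n - real (g n)" for n by (simp add: field_simps)
    have "filterlim (\<lambda>n. real n / 2) at_top sequentially"
      by (rule filterlim_at_top_mult_tendsto_pos[OF tendsto_const _ filterlim_real_sequentially, of "1/2", simplified])
    then show "filterlim (\<lambda>n. real n - real (g n)) at_top sequentially"
      by (rule filterlim_at_top_mono) (intro always_eventually allI half)
  qed simp
  moreover have "COMPLEX U (\<lambda>n. real (g n)) \<le>\<^sub>s LUA p"
  proof (rule strongly_reducibleI)
    \<comment> \<open>Bit \<open>pair m v\<close> tells whether \<open>X m = v\<close>; positions
      that code no pair get a harmless computable bit.\<close>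
    let ?Z = "\<lambda>X n. of_bool (X (pfst n) = psnd n) :: nat"
    show "rec_in True 1 (\<lambda>X xs. ?Z X (xs ! 0))"
      by (intro rec_in_intros; simp)
    fix X
    assume "X \<in> LUA p"
    then obtain \<psi> where X_less: "\<And>n. real (X n) < p n" and \<psi>: "linearly_universal \<psi>"
      and avoid: "\<And>n. \<psi> n \<noteq> Some (X n)"
      unfolding LUA_def by blast
    obtain \<upsilon> where \<upsilon>: "partial_recursive \<upsilon>" "\<And>\<sigma>. \<upsilon> (str_code \<sigma>) = map_option str_code (U \<sigma>)"
      using universal_code[OF U] by blast
    \<comment> \<open>\<open>\<theta>\<close> must be fixed before the coefficients with which
      \<open>\<psi>\<close> simulates it are known. Hence \<open>x\<close> carries them as
      components, and for the right ones \<open>\<psi> (pos x) = \<theta> x\<close>.\<close>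
    define pos where "pos x = pfst x * x + pfst (psnd x)" for x
    define Q where "Q x s v \<longleftrightarrow> odd ((s + 1) div 2 ^ pair (pos x) v)" for x s v :: nat
    define \<theta> where "\<theta> x = (case \<upsilon> (psnd (psnd x)) of None \<Rightarrow> None
      | Some s \<Rightarrow> if \<exists>v. Q x s v then Some (LEAST v. Q x s v) else None)" for x
    have "partial_recursive (\<lambda>x. \<upsilon> (psnd (psnd x)))"
      by (rule partial_recursive_comp[OF \<upsilon>(1)]) (intro rec_in_intros; simp)
    then have "partial_recursive \<theta>"
      unfolding \<theta>_def
      by (rule partial_recursive_search_in) (unfold Q_def pos_def, intro rec_in_intros; simp)
    then obtain A B where AB: "\<And>x. \<psi> (A * x + B) = \<theta> x"
      using \<psi> unfolding linearly_universal_def by blast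

    have undescribed: "U \<tau> \<noteq> Some (initial_segment (?Z X) n)"
      if k: "A \<le> k" "B \<le> k" "length \<tau> \<le> k" and n: "L k \<le> n" for \<tau> n k
    proof
      assume U_\<tau>: "U \<tau> = Some (initial_segment (?Z X) n)"
      define x where "x = pair A (pair B (str_code \<tau>))"
      have pos: "pos x = A * x + B" unfolding pos_def by (simp add: x_def)
      have "str_code \<tau> < 2 ^ Suc (length \<tau>)" using str_code_less[of \<tau>] by simp
      also have "\<dots> \<le> 2 ^ Suc k" using k(3) by (intro power_increasing) auto
      finally have "x \<le> pair k (pair k (2 ^ Suc k))"
        unfolding x_def using k by (intro pair_mono) auto
      then have pos_le: "pos x \<le> J k"
        unfolding pos J_def using k by (intro add_mono mult_le_mono) auto
      have "real (X (pos x)) < p (J k)"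
        using X_less[of "pos x"] monoD[OF \<open>mono p\<close> pos_le] by linarith
      also have "\<dots> \<le> real (a (J k) 0 + 1)" by (rule p_le)
      finally have "X (pos x) \<le> a (J k) 0 + 1" by simp
      with pos_le have pair_less: "pair (pos x) v < n" if "v \<le> X (pos x)" for v
        using pair_mono[of "pos x" "J k" v "a (J k) 0 + 1"] that L_ge[of k] n by linarith
      \<comment> \<open>All positions for \<open>v \<le> X (pos x)\<close> lie inside the segment,
        so the test is exact there. Bits met at larger \<open>v\<close>, such as the leading 1 of
        the code, cannot change the least solution.\<close>
      have Q_iff: "Q x (str_code (initial_segment (?Z X) n)) v \<longleftrightarrow> v = X (pos x)"
        if "v \<le> X (pos x)" for v
        unfolding Q_def using pair_less[OF that]
        by (subst str_code_bit) (auto simp: initial_segment_def)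
      then have "(LEAST v. Q x (str_code (initial_segment (?Z X) n)) v) = X (pos x)"
        by (intro Least_equality) (auto intro: ccontr)
      moreover have "\<upsilon> (psnd (psnd x)) = Some (str_code (initial_segment (?Z X) n))"
        unfolding x_def using \<upsilon>(2)[of \<tau>] U_\<tau> by simp
      ultimately have "\<theta> x = Some (X (pos x))"
        using Q_iff[of "X (pos x)"] unfolding \<theta>_def by auto
      then show False using AB[of x] avoid[of "pos x"] pos by simp
    qed
    \<comment> \<open>If \<open>g n\<close> is at most the constant, the left side is not positive.
      Otherwise \<open>k = g n - 1\<close> is at least \<open>A\<close> and \<open>B\<close> and
      satisfies \<open>L k \<le> n\<close>, so a shortest description is longer than
      \<open>g n - 1\<close>.\<close>
    have "real (g n) - real (Suc (max A B)) \<le> real (K U (initial_segment (?Z X) n))" for n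
    proof (cases "g n \<le> Suc (max A B)")
      case False
      obtain \<tau> where \<tau>: "U \<tau> = Some (initial_segment (?Z X) n)"
        "length \<tau> = K U (initial_segment (?Z X) n)"
        using K_attained[OF U] .
      have "A \<le> g n - 1" "B \<le> g n - 1" using False by linarith+
      moreover have "L (g n - 1) \<le> n" using False by (intro L_le) auto
      ultimately have "\<not> length \<tau> \<le> g n - 1"
        using undescribed \<tau>(1) by blast
      then show ?thesis using \<tau>(2) by linarith
    qed linarith
    then show "?Z X \<in> COMPLEX U (\<lambda>n. real (g n))"
      unfolding COMPLEX_def by (auto intro!: exI[of _ "Suc (max A B)"] simp del: of_nat_Suc of_nat_max)
  qed
  ultimately show ?thesis by blast
qed

theorem mainTheorem1:
  fixes U :: "bool list \<Rightarrow> bool list option"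
  assumes "universal_prefix_free_machine U"
  shows "(\<forall>f :: nat \<Rightarrow> real. order_function f \<and> sub_identical f \<longrightarrow>
            (\<exists>q :: nat \<Rightarrow> real. order_function q \<and> fast_growing q \<and> LUA q \<le>\<^sub>s COMPLEX U f)) \<and>
         (\<forall>p :: nat \<Rightarrow> real. order_function p \<and> fast_growing p \<longrightarrow>
            (\<exists>g :: nat \<Rightarrow> real. order_function g \<and> sub_identical g \<and> COMPLEX U g \<le>\<^sub>s LUA p))"
  using LUA_reducible_COMPLEX[OF assms] COMPLEX_reducible_LUA[OF assms] by blast

end
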